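(* Let $\mathcal{M}_r=(S,s_I,\mathrm{Act},\mathcal{P})$ be an MDP, let $T\subseteq S$, $\lambda\in[0,1]\cap\mathbb{Q}$, and let $\varphi$ be the specification "the probability of reaching $T$ from $s_I$ is at most $\lambda$". Let $\sigma_h$ be a strategy for $\mathcal{M}_r$ with $\sigma_h\not\models\varphi$ and let $b\colon S\to[0,1]$ be a blending function. Consider the following nonlinear program (NLP) over the variables $\sigma_a^{s,\alpha},\sigma_{ha}^{s,\alpha}\in[0,1]$, $\delta^{s,\alpha}\in[-1,1]$ (for $s\in S$, $\alpha\in\mathrm{Act}(s)$) and $p_s\in[0,1]$ (for $s\in S$): $$\begin{aligned} \text{minimize}\quad & \max\{|\delta^{s,\alpha}| : s\in S,\ \alpha\in\mathrm{Act}(s)\}\\ \text{subject to}\quad & p_{s_I}\le\lambda,\\ & p_s=1 && \forall s\in T,\\ & \textstyle\sum_{\alpha\in\mathrm{Act}(s)}\sigma_a^{s,\alpha}=\sum_{\alpha\in\mathrm{Act}(s)}\sigma_{ha}^{s,\alpha}=1 && \forall s\in S,\\ & \sigma_{ha}^{s,\alpha}=\sigma_h(s)(\alpha)+\delta^{s,\alpha} && \forall s\in S,\ \alpha\in\mathrm{Act}(s),\\ & \textstyle\sum_{\alpha\in\mathrm{Act}(s)}\delta^{s,\alpha}=0 && \forall s\in S,\\ & \sigma_{ha}^{s,\alpha}=b(s)\,\sigma_h(s)(\alpha)+(1-b(s))\,\sigma_a^{s,\alpha} && \forall s\in S,\ \alpha\in\mathrm{Act}(s),\\ & p_s=\textstyle\sum_{\alpha\in\mathrm{Act}(s)}\sigma_{ha}^{s,\alpha}\sum_{s'\in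 S}\mathcal{P}(s,\alpha)(s')\,p_{s'} && \forall s\in S\setminus T. \end{aligned}$$ Then: (Soundness) each minimizing assignment of the NLP induces a solution of the shared control synthesis problem for $(\mathcal{M}_r,\sigma_h,b,\varphi)$. (Completeness) for each solution of the shared control synthesis problem for $(\mathcal{M}_r,\sigma_h,b,\varphi)$ there is a minimizing assignment of the NLP that induces it.
   Context: An MDP $(S,s_I,\mathrm{Act},\mathcal{P})$ consists of a finite set of states $S$, an initial state $s_I\in S$, a finite set of actions $\mathrm{Act}$ and a partial function $\mathcal{P}\colon S\times\mathrm{Act}\to\mathrm{Distr}(S)$, where $\mathrm{Distr}(X)$ denotes the set of probability distributions on $X$. The set of enabled actions at $s$ is $\mathrm{Act}(s)=\{\alpha : \mathcal{P}(s,\alpha)\text{ is defined}\}$, and it is assumed that $\mathrm{Act}(s)\neq\emptyset$ for all $s$. A (memoryless randomized) strategy is a function $\sigma\colon S\to\mathrm{Distr}(\mathrm{Act})$ such that $\sigma(s)(\alpha)>0$ implies $\alpha\in\mathrm{Act}(s)$. The Markov chain induced by $\sigma$ has state space $S$, initial state $s_I$ and transition probabilities $\mathcal{P}^\sigma(s,s')=\sum_{\alpha\in\mathrm{Act}(s)}\sigma(s)(\alpha)\,\mathcal{P}(s,\alpha)(s')$. Write $\sigma\models\varphi$ if in this Markov chain the probability of eventually reaching $T$ from $s_I$ is at most $\lambda$. Blending: given strategies $\sigma_h,\sigma_a$ and $b\colon S\to[0,1]$, the blended strategy is $\sigma_{ha}(s)(\alpha)=b(s)\,\sigma_h(s)(\alpha)+(1-b(s))\,\sigma_a(s)(\alpha)$.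 Perturbation: a function $\delta\colon S\times\mathrm{Act}\to[-1,1]$ with $\sum_{\alpha}\delta(s,\alpha)=0$ for all $s$; the perturbed strategy is $\delta(\sigma)(s,\alpha)=\sigma(s)(\alpha)+\delta(s,\alpha)$. The deviation of a strategy $\sigma'$ from $\sigma_h$ is the infinity norm $\max_{s,\alpha}|\delta(s,\alpha)|$ of the perturbation $\delta$ with $\delta(\sigma_h)=\sigma'$. Shared control synthesis problem for $(\mathcal{M}_r,\sigma_h,b,\varphi)$: find a strategy $\sigma_a$ such that the blended strategy $\sigma_{ha}$ satisfies $\sigma_{ha}\models\varphi$ and such that the deviation of $\sigma_{ha}$ from $\sigma_h$ is minimal among all strategies $\sigma_a$ whose blended strategy satisfies $\varphi$. A solution is such a $\sigma_a$ (together with the resulting $\sigma_{ha}$ and perturbation $\delta$). An assignment maps the variables to real numbers; it is satisfying if all constraints (including variable ranges) hold, and minimizing if it is satisfying and no satisfying assignment has a strictly smaller objective value. An assignment induces the strategies $\sigma_a(s)(\alpha)=\sigma_a^{s,\alpha}$ and $\sigma_{ha}(s)(\alpha)=\sigma_{ha}^{s,\alpha}$ and the perturbation $\delta(s,\alpha)=\delta^{s,\alpha}$ for $\alpha\in\mathrm{Act}(s)$, with value $0$ for $\alpha\notin\mathrm{Act}(s)$. *)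

theory Defs
  imports "HOL-Probability.Probability"
begin

section \<open>Markov decision processes and strategies\<close>

text \<open>The finite sets of states and of actions are the finite types \<open>'s\<close> and \<open>'a\<close>.\<close>

record ('s, 'a) mdp =
  init :: 's
  trans :: "'s \<times> 'a \<rightharpoonup> 's pmf"

definition enabled :: "('s, 'a) mdp \<Rightarrow> 's \<Rightarrow> 'a set" where
  "enabled M s = {\<alpha>. (s, \<alpha>) \<in> dom (trans M)}"

definition is_mdp :: "('s, 'a) mdp \<Rightarrow> bool" where
  "is_mdp M \<longleftrightarrow> (\<forall>s. enabled M s \<noteq> {})"

definition prob_trans :: "('s, 'a) mdp \<Rightarrow> 's \<Rightarrow> 'a \<Rightarrow> 's \<Rightarrow> real" where
  "prob_trans M s \<alpha> s' = pmf (the (trans M (s, \<alpha>))) s'"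

definition is_strategy :: "('s, 'a) mdp \<Rightarrow> ('s \<Rightarrow> 'a pmf) \<Rightarrow> bool" where
  "is_strategy M \<sigma> \<longleftrightarrow> (\<forall>s \<alpha>. pmf (\<sigma> s) \<alpha> > 0 \<longrightarrow> \<alpha> \<in> enabled M s)"

definition induced_mc :: "('s::finite, 'a::finite) mdp \<Rightarrow> ('s \<Rightarrow> 'a pmf) \<Rightarrow> 's \<Rightarrow> 's pmf" where
  "induced_mc M \<sigma> s =
     embed_pmf (\<lambda>s'. \<Sum>\<alpha>\<in>enabled M s. pmf (\<sigma> s) \<alpha> * prob_trans M s \<alpha> s')"

lemma pmf_embed_pmf_finite:
  fixes f :: "'c::finite \<Rightarrow> real"
  assumes "\<And>x. 0 \<le> f x" and "(\<Sum>x\<in>UNIV. f x) = 1"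
  shows "pmf (embed_pmf f) x = f x"
  using assms
  by (intro pmf_embed_pmf) (auto simp: nn_integral_count_space_finite sum_ennreal)

lemma sum_strategy_enabled:
  fixes M :: "('s::finite, 'a::finite) mdp"
  assumes "is_strategy M \<sigma>"
  shows "(\<Sum>\<alpha>\<in>enabled M s. pmf (\<sigma> s) \<alpha>) = 1"
proof -
  have "(\<Sum>\<alpha>\<in>enabled M s. pmf (\<sigma> s) \<alpha>) = (\<Sum>\<alpha>\<in>UNIV. pmf (\<sigma> s) \<alpha>)"
    using assms unfolding is_strategy_def
    by (intro sum.mono_neutral_left) (auto simp: less_le)
  then show ?thesis
    by (simp add: sum_pmf_eq_1)
qed

lemma pmf_induced_mc:
  fixes M :: "('s::finite, 'a::finite) mdp"
  assumes "is_strategy M \<sigma>"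
  shows "pmf (induced_mc M \<sigma> s) s' =
    (\<Sum>\<alpha>\<in>enabled M s. pmf (\<sigma> s) \<alpha> * prob_trans M s \<alpha> s')"
  unfolding induced_mc_def
proof (rule pmf_embed_pmf_finite)
  show "(\<Sum>s'\<in>UNIV. \<Sum>\<alpha>\<in>enabled M s. pmf (\<sigma> s) \<alpha> * prob_trans M s \<alpha> s') = 1"
    by (subst sum.swap)
       (simp add: prob_trans_def sum_distrib_left[symmetric] sum_pmf_eq_1
          sum_strategy_enabled[OF assms])
qed (auto intro!: sum_nonneg simp: prob_trans_def)


section \<open>Path measure and reachability\<close>

text \<open>
  The path measure of the Markov chain with kernel \<open>K\<close> and initial state \<open>s\<close> is the
  Ionescu-Tulcea limit, a measure on \<open>nat \<Rightarrow> 's\<close>, of the kernels \<open>mc_step K s n\<close>, which give the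
  distribution of the \<open>n\<close>-th state as a function of the states at positions below \<open>n\<close>.
\<close>

definition mc_step :: "('s \<Rightarrow> 's pmf) \<Rightarrow> 's \<Rightarrow> nat \<Rightarrow> (nat \<Rightarrow> 's) \<Rightarrow> 's measure" where
  "mc_step K s n \<omega> = measure_pmf (if n = 0 then return_pmf s else K (\<omega> (n - 1)))"

interpretation MC: Ionescu_Tulcea "mc_step K s" "\<lambda>_. count_space UNIV" for K s
proof (rule Ionescu_Tulcea.intro)
  fix i :: nat
  show "mc_step K s i
      \<in> measurable (PiM {0..<i} (\<lambda>_. count_space UNIV)) (subprob_algebra (count_space UNIV))"
  proof (cases i)
    case 0
    then show ?thesis
      by (simp add: mc_step_def[abs_def] measure_pmf_in_subprob_algebra)
  next
    case (Suc n)
    have "(\<lambda>\<omega>. \<omega> n) \<in> measurable (PiM {0..<Suc n} (\<lambda>_. count_space UNIV)) (count_space UNIV)"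
      by (rule measurable_component_singleton) simp
    moreover have "(\<lambda>x. measure_pmf (K x))
        \<in> measurable (count_space UNIV) (subprob_algebra (count_space UNIV))"
      by (simp add: measure_pmf_in_subprob_algebra)
    ultimately show ?thesis
      using Suc by (simp add: mc_step_def[abs_def])
  qed
next
  fix i :: nat and x :: "nat \<Rightarrow> 'a"
  show "prob_space (mc_step K s i x)"
    by (simp add: mc_step_def measure_pmf.prob_space_axioms)
qed

definition path_measure :: "('s \<Rightarrow> 's pmf) \<Rightarrow> 's \<Rightarrow> (nat \<Rightarrow> 's) measure" where
  "path_measure K s = MC.PF.lim K s"

definition reach_prob :: "('s \<Rightarrow> 's pmf) \<Rightarrow> 's \<Rightarrow> 's set \<Rightarrow> real" where
  "reach_prob K s T = measure (path_measure K s) {\<omega>. \<exists>n. \<omega> n \<in> T}"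

lemma sets_path_measure: "sets (path_measure K s) = sets (PiM UNIV (\<lambda>_. count_space UNIV))"
  by (simp add: path_measure_def)

lemma space_path_measure: "space (path_measure K s) = UNIV"
  by (simp add: path_measure_def space_PiM)

lemma sets_reach: "{\<omega>. \<exists>n. \<omega> n \<in> T} \<in> sets (path_measure K s)"
proof -
  have "{\<omega>. \<exists>n::nat. \<omega> n \<in> T} =
      (\<Union>n. (\<lambda>\<omega>. \<omega> n) -` T \<inter> space (PiM UNIV (\<lambda>_. count_space UNIV)))"
    by (auto simp: space_PiM)
  also have "\<dots> \<in> sets (PiM UNIV (\<lambda>_. count_space UNIV))"
    by (rule sets.countable_UN)
       (auto intro!: measurable_sets[OF measurable_component_singleton])
  finally show ?thesis
    by (simp add: sets_path_measure)
qed

lemma emeasure_cylinder: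
  "emeasure (path_measure K s) {\<omega>. \<forall>i\<le>n. \<omega> i = x i} =
     ennreal (if x 0 = s then \<Prod>i<n. pmf (K (x i)) (x (Suc i)) else 0)"
proof -
  let ?N = "\<lambda>_::nat. count_space (UNIV :: 'a set)"
  let ?X = "\<lambda>n. {restrict x {0..<n}}"
  have X: "?X n \<in> sets (PiM {0..<n} ?N)" for n
  proof -
    have "?X n = PiE {0..<n} (\<lambda>i. {x i})"
      by (auto simp: PiE_singleton[symmetric] PiE_iff extensional_def fun_eq_iff restrict_def)
    also have "\<dots> \<in> sets (PiM {0..<n} ?N)"
      by (rule sets_PiM_I_finite) auto
    finally show ?thesis .
  qed
  have step: "emeasure (MC.C K s 0 (Suc n) (\<lambda>_. undefined)) (?X (Suc n)) =
      emeasure (MC.C K s 0 n (\<lambda>_. undefined)) (?X n) *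
      emeasure (mc_step K s n (restrict x {0..<n})) {x n}" for n
  proof -
    let ?C = "MC.C K s 0 n (\<lambda>_. undefined)"
    have sp: "space ?C = space (PiM {0..<n} ?N)"
      using MC.space_C[of "\<lambda>_. undefined" 0 K s n] by (simp add: space_PiM)
    have st: "sets ?C = sets (PiM {0..<n} ?N)"
      using MC.sets_C[of "\<lambda>_. undefined" 0 K s n] by (simp add: space_PiM)
    have "emeasure (MC.C K s 0 (Suc n) (\<lambda>_. undefined)) (?X (Suc n)) =
        emeasure (?C \<bind> MC.eP K s n) (?X (Suc n))"
      by simp
    also have "\<dots> = (\<integral>\<^sup>+\<omega>. emeasure (MC.eP K s n \<omega>) (?X (Suc n)) \<partial>?C)"
    proof (rule emeasure_bind[OF _ _ X])
      show "space ?C \<noteq> {}"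
        unfolding sp by (auto simp: space_PiM PiE_eq_empty_iff)
      show "MC.eP K s n \<in> measurable ?C (subprob_algebra (PiM {0..<Suc n} ?N))"
        using MC.measurable_eP[of K s n] measurable_cong_sets[OF st refl] by blast
    qed
    also have "\<dots> = (\<integral>\<^sup>+\<omega>. emeasure (mc_step K s n (restrict x {0..<n})) {x n} *
        indicator (?X n) \<omega> \<partial>?C)"
    proof (rule nn_integral_cong)
      fix \<omega> assume "\<omega> \<in> space ?C"
      then have w: "\<omega> \<in> space (PiM {0..<n} ?N)"
        by (simp add: sp)
      then have ext: "\<omega> \<in> extensional {0..<n}"
        by (simp add: space_PiM PiE_def)
      have "fun_upd \<omega> n -` ?X (Suc n) = (if \<omega> = restrict x {0..<n} then {x n} else {})"
      proof -
        have "fun_upd \<omega> n y = restrict x {0..<Suc n} \<longleftrightarrow> y = x n \<and> \<omega> = restrict x {0..<n}" for y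
        proof
          assume eq: "fun_upd \<omega> n y = restrict x {0..<Suc n}"
          have "\<omega> i = restrict x {0..<n} i" for i
            using fun_cong[OF eq, of i] ext
            by (cases "i < n") (auto simp: extensional_def)
          with fun_cong[OF eq, of n] show "y = x n \<and> \<omega> = restrict x {0..<n}"
            by (auto simp: fun_eq_iff)
        qed (auto simp: fun_eq_iff less_Suc_eq)
        then show ?thesis
          by auto
      qed
      then show "emeasure (MC.eP K s n \<omega>) (?X (Suc n)) =
          emeasure (mc_step K s n (restrict x {0..<n})) {x n} * indicator (?X n) \<omega>"
        using MC.emeasure_eP[OF w X] by (auto split: split_indicator)
    qed
    also have "\<dots> = emeasure (mc_step K s n (restrict x {0..<n})) {x n} * emeasure ?C (?X n)"
      using X[of n] by (intro nn_integral_cmult_indicator) (simp add: st)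
    finally show ?thesis
      by (simp add: mult.commute)
  qed
  have C: "emeasure (MC.C K s 0 (Suc n) (\<lambda>_. undefined)) (?X (Suc n)) =
      ennreal (if x 0 = s then \<Prod>i<n. pmf (K (x i)) (x (Suc i)) else 0)" for n
  proof (induction n)
    case 0
    have "emeasure (MC.C K s 0 0 (\<lambda>_. undefined)) (?X 0) = 1"
      using X[of 0] by (simp add: restrict_def)
    moreover have "emeasure (mc_step K s 0 (restrict x {0..<0})) {x 0} = indicator {x 0} s"
      by (simp add: mc_step_def)
    ultimately show ?case
      unfolding step by (auto simp: indicator_def simp del: MC.C.simps)
  next
    case (Suc n)
    have "emeasure (mc_step K s (Suc n) (restrict x {0..<Suc n})) {x (Suc n)} =
        ennreal (pmf (K (x n)) (x (Suc n)))"
      by (simp add: mc_step_def emeasure_pmf_single)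
    then show ?case
      unfolding step[of "Suc n"] Suc.IH by (simp add: ennreal_mult' prod_nonneg del: MC.C.simps)
  qed
  have "{\<omega>. \<forall>i\<le>n. \<omega> i = x i} = prod_emb UNIV ?N {0..<Suc n} (?X (Suc n))"
    by (simp add: prod_emb_def fun_eq_iff restrict_def space_PiM less_Suc_eq_le set_eq_iff)
  then have "emeasure (path_measure K s) {\<omega>. \<forall>i\<le>n. \<omega> i = x i} =
      emeasure (MC.CI K s {0..<Suc n}) (?X (Suc n))"
    using MC.lim[OF _ X] by (simp add: path_measure_def)
  also have "\<dots> = emeasure (MC.C K s 0 (Suc n) (\<lambda>_. undefined))
      (prod_emb {0..<Suc n} ?N {0..<Suc n} (?X (Suc n)))"
    by (rule MC.emeasure_CI[OF subset_refl X])
  also have "prod_emb {0..<Suc n} ?N {0..<Suc n} (?X (Suc n)) = ?X (Suc n)"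
    by (rule prod_emb_id) (use sets.sets_into_space[OF X[of "Suc n"]] in \<open>simp add: space_PiM\<close>)
  finally show ?thesis
    by (simp only: C)
qed

definition satisfies_reach ::
  "('s::finite, 'a::finite) mdp \<Rightarrow> 's set \<Rightarrow> real \<Rightarrow> ('s \<Rightarrow> 'a pmf) \<Rightarrow> bool" where
  "satisfies_reach M T lam \<sigma> \<longleftrightarrow> reach_prob (induced_mc M \<sigma>) (init M) T \<le> lam"


section \<open>Blending, perturbation and the synthesis problem\<close>

definition blend ::
  "('s \<Rightarrow> real) \<Rightarrow> ('s \<Rightarrow> 'a::finite pmf) \<Rightarrow> ('s \<Rightarrow> 'a pmf) \<Rightarrow> 's \<Rightarrow> 'a pmf" where
  "blend b \<sigma>h \<sigma>a s = embed_pmf (\<lambda>\<alpha>. b s * pmf (\<sigma>h s) \<alpha> + (1 - b s) * pmf (\<sigma>a s) \<alpha>)"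

lemma pmf_blend:
  fixes \<sigma>h \<sigma>a :: "'s \<Rightarrow> 'a::finite pmf"
  assumes "b s \<in> {0..1}"
  shows "pmf (blend b \<sigma>h \<sigma>a s) \<alpha> = b s * pmf (\<sigma>h s) \<alpha> + (1 - b s) * pmf (\<sigma>a s) \<alpha>"
  unfolding blend_def
proof (rule pmf_embed_pmf_finite)
  show "(\<Sum>\<alpha>\<in>UNIV. b s * pmf (\<sigma>h s) \<alpha> + (1 - b s) * pmf (\<sigma>a s) \<alpha>) = 1"
    by (simp add: sum.distrib sum_distrib_left[symmetric] sum_pmf_eq_1)
qed (use assms in auto)

definition is_perturbation :: "('s \<Rightarrow> 'a::finite \<Rightarrow> real) \<Rightarrow> bool" where
  "is_perturbation \<delta> \<longleftrightarrow> (\<forall>s \<alpha>. \<delta> s \<alpha> \<in> {-1..1}) \<and> (\<forall>s. (\<Sum>\<alpha>\<in>UNIV. \<delta> s \<alpha>) = 0)"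

definition perturbs ::
  "('s \<Rightarrow> 'a::finite \<Rightarrow> real) \<Rightarrow> ('s \<Rightarrow> 'a pmf) \<Rightarrow> ('s \<Rightarrow> 'a pmf) \<Rightarrow> bool" where
  "perturbs \<delta> \<sigma> \<sigma>' \<longleftrightarrow>
     is_perturbation \<delta> \<and> (\<forall>s \<alpha>. pmf (\<sigma>' s) \<alpha> = pmf (\<sigma> s) \<alpha> + \<delta> s \<alpha>)"

definition inf_norm :: "('s::finite \<Rightarrow> 'a::finite \<Rightarrow> real) \<Rightarrow> real" where
  "inf_norm \<delta> = Max {\<bar>\<delta> s \<alpha>\<bar> | s \<alpha>. True}"

definition deviation :: "('s::finite \<Rightarrow> 'a::finite pmf) \<Rightarrow> ('s \<Rightarrow> 'a pmf) \<Rightarrow> real" where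
  "deviation \<sigma>h \<sigma>' = inf_norm (THE \<delta>. perturbs \<delta> \<sigma>h \<sigma>')"

lemma perturbs_iff:
  fixes \<sigma> \<sigma>' :: "'s \<Rightarrow> 'a::finite pmf"
  shows "perturbs \<delta> \<sigma> \<sigma>' \<longleftrightarrow> \<delta> = (\<lambda>s \<alpha>. pmf (\<sigma>' s) \<alpha> - pmf (\<sigma> s) \<alpha>)"
proof
  assume "perturbs \<delta> \<sigma> \<sigma>'"
  then show "\<delta> = (\<lambda>s \<alpha>. pmf (\<sigma>' s) \<alpha> - pmf (\<sigma> s) \<alpha>)"
    by (auto simp: perturbs_def fun_eq_iff)
next
  assume d: "\<delta> = (\<lambda>s \<alpha>. pmf (\<sigma>' s) \<alpha> - pmf (\<sigma> s) \<alpha>)"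
  have "\<delta> s \<alpha> \<in> {-1..1}" for s \<alpha>
    using pmf_nonneg[of "\<sigma> s" \<alpha>] pmf_le_1[of "\<sigma> s" \<alpha>]
      pmf_nonneg[of "\<sigma>' s" \<alpha>] pmf_le_1[of "\<sigma>' s" \<alpha>]
    unfolding d atLeastAtMost_iff by linarith
  then show "perturbs \<delta> \<sigma> \<sigma>'"
    by (simp add: d perturbs_def is_perturbation_def sum_subtractf sum_pmf_eq_1)
qed

lemma deviation_eq:
  "deviation \<sigma>h \<sigma>' = inf_norm (\<lambda>s \<alpha>. pmf (\<sigma>' s) \<alpha> - pmf (\<sigma>h s) \<alpha>)"
  by (simp add: deviation_def perturbs_iff)

definition synthesis_solution ::
  "('s::finite, 'a::finite) mdp \<Rightarrow> ('s \<Rightarrow> 'a pmf) \<Rightarrow> ('s \<Rightarrow> real) \<Rightarrow> 's set \<Rightarrow> real \<Rightarrow>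
    ('s \<Rightarrow> 'a pmf) \<Rightarrow> ('s \<Rightarrow> 'a pmf) \<Rightarrow> ('s \<Rightarrow> 'a \<Rightarrow> real) \<Rightarrow> bool" where
  "synthesis_solution M \<sigma>h b T lam \<sigma>a \<sigma>ha \<delta> \<longleftrightarrow>
     is_strategy M \<sigma>a \<and>
     \<sigma>ha = blend b \<sigma>h \<sigma>a \<and>
     perturbs \<delta> \<sigma>h \<sigma>ha \<and>
     satisfies_reach M T lam \<sigma>ha \<and>
     (\<forall>\<sigma>a'. is_strategy M \<sigma>a' \<and> satisfies_reach M T lam (blend b \<sigma>h \<sigma>a') \<longrightarrow>
        deviation \<sigma>h \<sigma>ha \<le> deviation \<sigma>h (blend b \<sigma>h \<sigma>a'))"


section \<open>The nonlinear program\<close>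

text \<open>
  The program only has variables \<open>var_a x s \<alpha>\<close>, \<open>var_ha x s \<alpha>\<close> and \<open>var_d x s \<alpha>\<close> for
  \<open>\<alpha> \<in> enabled M s\<close>; the values of these total functions elsewhere are never read.
\<close>

record ('s, 'a) assignment =
  var_a :: "'s \<Rightarrow> 'a \<Rightarrow> real"
  var_ha :: "'s \<Rightarrow> 'a \<Rightarrow> real"
  var_d :: "'s \<Rightarrow> 'a \<Rightarrow> real"
  var_p :: "'s \<Rightarrow> real"

definition nlp_objective :: "('s, 'a) mdp \<Rightarrow> ('s, 'a) assignment \<Rightarrow> real" where
  "nlp_objective M x = Max {\<bar>var_d x s \<alpha>\<bar> | s \<alpha>. \<alpha> \<in> enabled M s}"

definition nlp_satisfying ::
  "('s::finite, 'a::finite) mdp \<Rightarrow> ('s \<Rightarrow> 'a pmf) \<Rightarrow> ('s \<Rightarrow> real) \<Rightarrow> 's set \<Rightarrow> real \<Rightarrow>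
    ('s, 'a) assignment \<Rightarrow> bool" where
  "nlp_satisfying M \<sigma>h b T lam x \<longleftrightarrow>
     (\<forall>s. \<forall>\<alpha>\<in>enabled M s.
        var_a x s \<alpha> \<in> {0..1} \<and> var_ha x s \<alpha> \<in> {0..1} \<and> var_d x s \<alpha> \<in> {-1..1}) \<and>
     (\<forall>s. var_p x s \<in> {0..1}) \<and>
     var_p x (init M) \<le> lam \<and>
     (\<forall>s\<in>T. var_p x s = 1) \<and>
     (\<forall>s. (\<Sum>\<alpha>\<in>enabled M s. var_a x s \<alpha>) = 1 \<and> (\<Sum>\<alpha>\<in>enabled M s. var_ha x s \<alpha>) = 1) \<and>
     (\<forall>s. \<forall>\<alpha>\<in>enabled M s. var_ha x s \<alpha> = pmf (\<sigma>h s) \<alpha> + var_d x s \<alpha>) \<and>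
     (\<forall>s. (\<Sum>\<alpha>\<in>enabled M s. var_d x s \<alpha>) = 0) \<and>
     (\<forall>s. \<forall>\<alpha>\<in>enabled M s.
        var_ha x s \<alpha> = b s * pmf (\<sigma>h s) \<alpha> + (1 - b s) * var_a x s \<alpha>) \<and>
     (\<forall>s\<in>UNIV - T. var_p x s =
        (\<Sum>\<alpha>\<in>enabled M s. var_ha x s \<alpha> * (\<Sum>s'\<in>UNIV. prob_trans M s \<alpha> s' * var_p x s')))"

definition nlp_minimizing ::
  "('s::finite, 'a::finite) mdp \<Rightarrow> ('s \<Rightarrow> 'a pmf) \<Rightarrow> ('s \<Rightarrow> real) \<Rightarrow> 's set \<Rightarrow> real \<Rightarrow>
    ('s, 'a) assignment \<Rightarrow> bool" where
  "nlp_minimizing M \<sigma>h b T lam x \<longleftrightarrow>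
     nlp_satisfying M \<sigma>h b T lam x \<and>
     \<not> (\<exists>y. nlp_satisfying M \<sigma>h b T lam y \<and> nlp_objective M y < nlp_objective M x)"

definition induces ::
  "('s, 'a) mdp \<Rightarrow> ('s, 'a) assignment \<Rightarrow>
    ('s \<Rightarrow> 'a pmf) \<Rightarrow> ('s \<Rightarrow> 'a pmf) \<Rightarrow> ('s \<Rightarrow> 'a \<Rightarrow> real) \<Rightarrow> bool" where
  "induces M x \<sigma>a \<sigma>ha \<delta> \<longleftrightarrow>
     (\<forall>s \<alpha>. pmf (\<sigma>a s) \<alpha> = (if \<alpha> \<in> enabled M s then var_a x s \<alpha> else 0)) \<and>
     (\<forall>s \<alpha>. pmf (\<sigma>ha s) \<alpha> = (if \<alpha> \<in> enabled M s then var_ha x s \<alpha> else 0)) \<and>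
     (\<forall>s \<alpha>. \<delta> s \<alpha> = (if \<alpha> \<in> enabled M s then var_d x s \<alpha> else 0))"

lemma induces_unique:
  assumes "induces M x \<sigma>a \<sigma>ha \<delta>" and "induces M x \<sigma>a' \<sigma>ha' \<delta>'"
  shows "\<sigma>a = \<sigma>a' \<and> \<sigma>ha = \<sigma>ha' \<and> \<delta> = \<delta>'"
  using assms unfolding induces_def by (auto intro!: ext pmf_eqI)

end

(*
  The vector of reachability probabilities is the least nonnegative solution of the equations that
  the program imposes on p: the probability of reaching T within n steps obeys the corresponding
  recursion, so it stays below every solution, and its limit is a solution. Hence every feasible p
  satisfies Pr(reach T from s_I) <= p_{s_I} <= lam, while conversely the reachability probabilities
  themselves are a feasible p. Feasible assignments thus correspond to strategies whose blending
  satisfies the specification, and the objective is the deviation.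
*)

theory Submission
  imports Defs
begin

section \<open>Reachability probabilities as a least fixed point\<close>

text \<open>The transition operator killed on \<open>T\<close>: its n-th iterate at the constant 1
  is the probability that positions 1 to n avoid \<open>T\<close>. The starting state is not tested,
  hence the case split on \<open>s \<in> T\<close> in what follows.\<close>

definition taboo_step :: "('s::finite \<Rightarrow> 's pmf) \<Rightarrow> 's set \<Rightarrow> ('s \<Rightarrow> real) \<Rightarrow> 's \<Rightarrow> real" where
  "taboo_step K T h t = (\<Sum>t'\<in>-T. pmf (K t) t' * h t')"

text \<open>The real value that \<open>emeasure_cylinder\<close> assigns to the set of paths
  agreeing with \<open>x\<close> at positions 0 to n.\<close>

definition cylinder_weight :: "('s \<Rightarrow> 's pmf) \<Rightarrow> 's \<Rightarrow> nat \<Rightarrow> (nat \<Rightarrow> 's) \<Rightarrow> real" where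
  "cylinder_weight K s n x = (if x 0 = s then \<Prod>i<n. pmf (K (x i)) (x (Suc i)) else 0)"

text \<open>Weighting the paths by a function of their last state lets the induction peel off the last
  step, while the iterate of \<open>taboo_step\<close> can be unfolded from the first step.\<close>

lemma sum_cylinder_weight_taboo:
  fixes K :: "'s::finite \<Rightarrow> 's pmf"
  shows "(\<Sum>x\<in>PiE {..n} (\<lambda>_. - T). cylinder_weight K s n x * h (x n)) =
    (if s \<in> T then 0 else (taboo_step K T ^^ n) h s)"
proof (induction n arbitrary: h)
  case 0
  have "(\<Sum>x\<in>PiE {..0::nat} (\<lambda>_. - T). cylinder_weight K s 0 x * h (x 0)) =
      (\<Sum>t\<in>-T. if t = s then h t else 0)"
    by (rule sum.reindex_bij_witness[where j = "\<lambda>x. x 0" and i = "\<lambda>t. \<lambda>i\<in>{..0}. t"])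
      (auto simp: cylinder_weight_def PiE_iff extensional_def fun_eq_iff restrict_def)
  then show ?case
    by (simp add: sum.delta)
next
  case (Suc n)
  let ?P = "PiE {..n} (\<lambda>_. - T)"
  have "(\<Sum>x\<in>PiE {..Suc n} (\<lambda>_. - T). cylinder_weight K s (Suc n) x * h (x (Suc n))) =
      (\<Sum>(t, x)\<in>(-T) \<times> ?P. cylinder_weight K s (Suc n) (x(Suc n := t)) * h t)"
    unfolding atMost_Suc PiE_insert_eq
    by (subst sum.reindex) (auto intro!: inj_combinator sum.cong simp: case_prod_beta)
  \<comment> \<open>Overwriting position \<open>Suc n\<close> leaves the start and the first n
    transitions unchanged, so exactly the last transition splits off.\<close>
  also have "\<dots> = (\<Sum>t\<in>-T. \<Sum>x\<in>?P. cylinder_weight K s n x * (pmf (K (x n)) t * h t))"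
    unfolding sum.cartesian_product[symmetric]
    by (intro sum.cong refl) (auto simp: cylinder_weight_def intro!: prod.cong)
  also have "\<dots> = (\<Sum>x\<in>?P. cylinder_weight K s n x * taboo_step K T h (x n))"
    by (subst sum.swap) (simp add: taboo_step_def sum_distrib_left)
  \<comment> \<open>The last transition now sits in the end weight, so the induction hypothesis is
    used at \<open>taboo_step K T h\<close>; \<open>funpow_Suc_right\<close> supplies this innermost
    application.\<close>
  also have "\<dots> = (if s \<in> T then 0 else (taboo_step K T ^^ Suc n) h s)"
    by (simp add: Suc.IH funpow_Suc_right del: funpow.simps)
  finally show ?case .
qed

lemma sets_path_measure_coord: "{\<omega>. \<omega> i \<in> A} \<in> sets (path_measure K s)"
proof -
  have "{\<omega>. \<omega> i \<in> A} = (\<lambda>\<omega>. \<omega> i) -` A \<inter> space (PiM UNIV (\<lambda>_::nat. count_space UNIV))"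
    by (auto simp: space_PiM)
  also have "\<dots> \<in> sets (PiM UNIV (\<lambda>_. count_space UNIV))"
    by (auto intro!: measurable_sets[OF measurable_component_singleton])
  finally show ?thesis
    by (simp add: sets_path_measure)
qed

lemma sets_path_measure_coords: "{\<omega>. \<forall>i\<le>n. \<omega> i \<in> A i} \<in> sets (path_measure K s)"
proof -
  have "{\<omega>. \<forall>i\<le>n. \<omega> i \<in> A i} = (\<Inter>i\<in>{..n}. {\<omega>. \<omega> i \<in> A i})"
    by auto
  also have "\<dots> \<in> sets (path_measure K s)"
    by (intro sets.finite_INT sets_path_measure_coord) auto
  finally show ?thesis .
qed

text \<open>Only positions 0 to n matter and there are finitely many states, so the event splits
  into finitely many disjoint cylinders, whose weights are summed with constant end weight
  1.\<close>

lemma measure_avoid: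
  fixes K :: "'s::finite \<Rightarrow> 's pmf"
  shows "measure (path_measure K s) {\<omega>. \<forall>i\<le>n. \<omega> i \<notin> T} =
    (if s \<in> T then 0 else (taboo_step K T ^^ n) (\<lambda>_. 1) s)"
proof -
  let ?P = "PiE {..n} (\<lambda>_. - T)" and ?C = "\<lambda>x. {\<omega>. \<forall>i\<le>n. \<omega> i = x i}"
  have "{\<omega>. \<forall>i\<le>n. \<omega> i \<notin> T} = (\<Union>x\<in>?P. ?C x)"
  proof (intro set_eqI iffI)
    fix \<omega> assume "\<omega> \<in> {\<omega>. \<forall>i\<le>n. \<omega> i \<notin> T}"
    then show "\<omega> \<in> (\<Union>x\<in>?P. ?C x)"
      by (intro UN_I[of "restrict \<omega> {..n}"]) auto
  qed (auto simp: PiE_iff)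
  also have "measure (path_measure K s) \<dots> = (\<Sum>x\<in>?P. measure (path_measure K s) (?C x))"
  proof (rule measure_finite_Union)
    show "disjoint_family_on ?C ?P"
    proof (unfold disjoint_family_on_def, safe)
      fix x y \<omega> assume xy: "x \<in> ?P" "y \<in> ?P" "x \<noteq> y" "\<forall>i\<le>n. \<omega> i = x i" "\<forall>i\<le>n. \<omega> i = y i"
      then have "x = y"
        by (intro PiE_ext[OF xy(1,2)]) auto
      with \<open>x \<noteq> y\<close> show "\<omega> \<in> {}" ..
    qed
    show "?C ` ?P \<subseteq> sets (path_measure K s)"
      using sets_path_measure_coords[of n "\<lambda>i. {x i}" K s for x] by auto
  qed (auto simp: emeasure_cylinder intro!: finite_PiE)
  also have "\<dots> = (\<Sum>x\<in>?P. cylinder_weight K s n x * 1)"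
    by (intro sum.cong refl)
      (auto simp: measure_def emeasure_cylinder cylinder_weight_def prod_nonneg)
  finally show ?thesis
    by (simp only: sum_cylinder_weight_taboo[where h = "\<lambda>_. 1"])
qed

lemma prob_space_path_measure:
  fixes K :: "'s::finite \<Rightarrow> 's pmf"
  shows "prob_space (path_measure K s)"
proof (rule prob_spaceI)
  \<comment> \<open>For \<open>T = {}\<close> the avoidance event is the whole space, and the
    iterate for n = 0 is the constant 1.\<close>
  have "measure (path_measure K s) UNIV = 1"
    using measure_avoid[of K s 0 "{}"] by simp
  \<comment> \<open>A real measure of 1 excludes an infinite \<open>emeasure\<close>, since
    \<open>enn2real\<close> maps top to 0.\<close>
  then have "emeasure (path_measure K s) UNIV = 1"
    by (metis emeasure_eq_ennreal_measure ennreal_1 infinity_ennreal_def measure_def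
        enn2real_top zero_neq_one)
  then show "emeasure (path_measure K s) (space (path_measure K s)) = 1"
    by (simp add: space_path_measure)
qed

section \<open>Step-bounded reachability and its limit\<close>

definition reach_within :: "('s \<Rightarrow> 's pmf) \<Rightarrow> 's \<Rightarrow> 's set \<Rightarrow> nat \<Rightarrow> real" where
  "reach_within K s T n = measure (path_measure K s) {\<omega>. \<exists>i\<le>n. \<omega> i \<in> T}"

lemma reach_within_eq:
  fixes K :: "'s::finite \<Rightarrow> 's pmf"
  shows "reach_within K s T n = (if s \<in> T then 1 else 1 - (taboo_step K T ^^ n) (\<lambda>_. 1) s)"
proof -
  interpret prob_space "path_measure K s"
    by (rule prob_space_path_measure)
  have "{\<omega>. \<exists>i\<le>n. \<omega> i \<in> T} = space (path_measure K s) - {\<omega>. \<forall>i\<le>n. \<omega> i \<notin> T}"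
    by (auto simp: space_path_measure)
  moreover have "{\<omega>. \<forall>i\<le>n. \<omega> i \<notin> T} \<in> sets (path_measure K s)"
    using sets_path_measure_coords[of n "\<lambda>_. - T" K s] by simp
  ultimately show ?thesis
    by (simp add: reach_within_def prob_compl measure_avoid)
qed

lemma reach_within_0:
  fixes K :: "'s::finite \<Rightarrow> 's pmf"
  shows "reach_within K s T 0 = (if s \<in> T then 1 else 0)"
  by (simp add: reach_within_eq)

text \<open>The outermost \<open>taboo_step\<close> is the first transition, so unfolding the
  iterate conditions on the first step without shifting paths.\<close>

lemma reach_within_Suc:
  fixes K :: "'s::finite \<Rightarrow> 's pmf"
  assumes "s \<notin> T"
  shows "reach_within K s T (Suc n) = (\<Sum>t\<in>UNIV. pmf (K s) t * reach_within K t T n)"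
proof -
  \<comment> \<open>Avoidance probabilities, set to 0 on \<open>T\<close> so that the sum over
    \<open>-T\<close> extends to all states. Complementing then uses that \<open>K s\<close> has
    total mass 1.\<close>
  let ?a = "\<lambda>t. if t \<in> T then 0 else (taboo_step K T ^^ n) (\<lambda>_. 1) t"
  have "(\<Sum>t\<in>UNIV. pmf (K s) t * ?a t) =
      (\<Sum>t\<in>-T. pmf (K s) t * (taboo_step K T ^^ n) (\<lambda>_. 1) t)"
    by (rule sum.mono_neutral_cong_right) auto
  also have "\<dots> = (taboo_step K T ^^ Suc n) (\<lambda>_. 1) s"
    by (simp add: taboo_step_def)
  finally have "(\<Sum>t\<in>UNIV. pmf (K s) t * ?a t) = (taboo_step K T ^^ Suc n) (\<lambda>_. 1) s" .
  moreover have "reach_within K t T n = 1 - ?a t" for t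
    by (simp add: reach_within_eq)
  ultimately show ?thesis
    using assms
    by (simp add: reach_within_eq[of K s] right_diff_distrib sum_subtractf sum_pmf_eq_1
        del: funpow.simps)
qed

text \<open>Continuity from below: the step-bounded events increase to eventual
  reachability.\<close>

lemma reach_within_tendsto:
  fixes K :: "'s::finite \<Rightarrow> 's pmf"
  shows "reach_within K s T \<longlonglongrightarrow> reach_prob K s T"
proof -
  interpret prob_space "path_measure K s"
    by (rule prob_space_path_measure)
  let ?A = "\<lambda>n::nat. {\<omega>. \<exists>i\<le>n. \<omega> i \<in> T}"
  have "?A n = space (path_measure K s) - {\<omega>. \<forall>i\<le>n. \<omega> i \<in> - T}" for n
    by (auto simp: space_path_measure)
  then have "range ?A \<subseteq> sets (path_measure K s)"
    using sets_path_measure_coords[of _ "\<lambda>_. - T" K s] by auto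
  moreover have "incseq ?A"
    unfolding incseq_def by (blast intro: order_trans)
  ultimately have "(\<lambda>n. prob (?A n)) \<longlonglongrightarrow> prob (\<Union>n. ?A n)"
    by (rule finite_Lim_measure_incseq)
  moreover have "(\<Union>n. ?A n) = {\<omega>. \<exists>n. \<omega> n \<in> T}"
    by auto
  ultimately show ?thesis
    by (simp add: reach_within_def[abs_def] reach_prob_def)
qed

section \<open>Fixed-point equations and minimality\<close>

lemma reach_prob_range:
  fixes K :: "'s::finite \<Rightarrow> 's pmf"
  shows "reach_prob K s T \<in> {0..1}"
  using prob_space.prob_le_1[OF prob_space_path_measure] by (simp add: reach_prob_def)

lemma reach_prob_target:
  fixes K :: "'s::finite \<Rightarrow> 's pmf"
  assumes "s \<in> T"
  shows "reach_prob K s T = 1"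
  using reach_within_tendsto[of K s T] assms
  by (intro LIMSEQ_unique[OF _ tendsto_const]) (simp add: reach_within_eq[abs_def])

text \<open>The limit of the step-bounded recursion; it passes through the sum because there are
  finitely many states.\<close>

lemma reach_prob_step:
  fixes K :: "'s::finite \<Rightarrow> 's pmf"
  assumes "s \<notin> T"
  shows "reach_prob K s T = (\<Sum>t\<in>UNIV. pmf (K s) t * reach_prob K t T)"
proof (rule LIMSEQ_unique)
  show "(\<lambda>n. reach_within K s T (Suc n)) \<longlonglongrightarrow> reach_prob K s T"
    using reach_within_tendsto by (rule LIMSEQ_Suc)
  show "(\<lambda>n. reach_within K s T (Suc n)) \<longlonglongrightarrow> (\<Sum>t\<in>UNIV. pmf (K s) t * reach_prob K t T)"
    unfolding reach_within_Suc[OF assms]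
    by (intro tendsto_sum tendsto_mult tendsto_const reach_within_tendsto)
qed

lemma reach_prob_least:
  fixes K :: "'s::finite \<Rightarrow> 's pmf"
  assumes nonneg: "\<And>s. 0 \<le> p s" and target: "\<And>s. s \<in> T \<Longrightarrow> 1 \<le> p s"
    and step: "\<And>s. s \<notin> T \<Longrightarrow> (\<Sum>t\<in>UNIV. pmf (K s) t * p t) \<le> p s"
  shows "reach_prob K s T \<le> p s"
proof -
  \<comment> \<open>The hypothesis is needed at all successors, so the state is generalized. The
    bound is uniform in n and hence survives the limit.\<close>
  have "reach_within K s T n \<le> p s" for n s
  proof (induction n arbitrary: s)
    case 0
    then show ?case
      using nonneg target by (simp add: reach_within_0)
  next
    case (Suc n)
    show ?case
    proof (cases "s \<in> T")
      case True
      then show ?thesis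
        using target by (simp add: reach_within_eq)
    next
      case False
      have "reach_within K s T (Suc n) \<le> (\<Sum>t\<in>UNIV. pmf (K s) t * p t)"
        unfolding reach_within_Suc[OF False]
        by (intro sum_mono mult_left_mono Suc.IH) auto
      with step[OF False] show ?thesis
        by simp
    qed
  qed
  then show ?thesis
    by (intro LIMSEQ_le_const2[OF reach_within_tendsto]) auto
qed


section \<open>Feasible assignments and strategies\<close>

lemma is_strategy_iff: "is_strategy M \<sigma> \<longleftrightarrow> (\<forall>s \<alpha>. \<alpha> \<notin> enabled M s \<longrightarrow> pmf (\<sigma> s) \<alpha> = 0)"
  unfolding is_strategy_def by (metis less_irrefl pmf_nonneg less_le)

lemma is_strategy_blend:
  assumes "is_strategy M \<sigma>h" and "is_strategy M \<sigma>a" and "\<forall>s. b s \<in> {0..1}"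
  shows "is_strategy M (blend b \<sigma>h \<sigma>a)"
  using assms by (auto simp: is_strategy_iff pmf_blend)

text \<open>Exchanging the sums over states and actions matches the fixed-point equation of the
  chain with the program's equation for \<open>var_p\<close>.\<close>

lemma sum_induced_mc:
  fixes M :: "('s::finite, 'a::finite) mdp"
  assumes "is_strategy M \<sigma>"
  shows "(\<Sum>s'\<in>UNIV. pmf (induced_mc M \<sigma> s) s' * p s') =
    (\<Sum>\<alpha>\<in>enabled M s. pmf (\<sigma> s) \<alpha> * (\<Sum>s'\<in>UNIV. prob_trans M s \<alpha> s' * p s'))"
  unfolding pmf_induced_mc[OF assms] sum_distrib_right sum_distrib_left
  by (subst sum.swap) (simp add: mult.assoc)

text \<open>Entries at disabled pairs are 0, hence dominated by the absolute value at any enabled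
  pair, and an MDP has such a pair.\<close>

lemma inf_norm_eq_Max_enabled:
  fixes M :: "('s::finite, 'a::finite) mdp"
  assumes "is_mdp M" and zero: "\<And>s \<alpha>. \<alpha> \<notin> enabled M s \<Longrightarrow> \<delta> s \<alpha> = 0"
    and eq: "\<And>s \<alpha>. \<alpha> \<in> enabled M s \<Longrightarrow> \<delta> s \<alpha> = d s \<alpha>"
  shows "inf_norm \<delta> = Max {\<bar>d s \<alpha>\<bar> | s \<alpha>. \<alpha> \<in> enabled M s}"
proof -
  let ?A = "{\<bar>\<delta> s \<alpha>\<bar> | s \<alpha>. True}" and ?B = "{\<bar>d s \<alpha>\<bar> | s \<alpha>. \<alpha> \<in> enabled M s}"
  have A: "?A = (\<lambda>(s, \<alpha>). \<bar>\<delta> s \<alpha>\<bar>) ` UNIV"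
    by auto
  have B: "?B = (\<lambda>(s, \<alpha>). \<bar>\<delta> s \<alpha>\<bar>) ` (SIGMA s:UNIV. enabled M s)"
    using eq by (force simp: image_iff)
  have fin: "finite ?A" "finite ?B"
    unfolding A B by simp_all
  obtain s0 \<alpha>0 where "\<alpha>0 \<in> enabled M s0"
    using assms(1) unfolding is_mdp_def by blast
  then have ne: "\<bar>d s0 \<alpha>0\<bar> \<in> ?B"
    by blast
  have "Max ?A = Max ?B"
  proof (rule antisym)
    have "\<bar>\<delta> s \<alpha>\<bar> \<le> Max ?B" for s \<alpha>
    proof (cases "\<alpha> \<in> enabled M s")
      case True
      then show ?thesis
        using fin(2) eq by (intro Max_ge) auto
    next
      case False
      then show ?thesis
        using zero Max_ge[OF fin(2) ne] by simp
    qed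
    then show "Max ?A \<le> Max ?B"
      using fin(1) by (subst Max_le_iff) auto
    show "Max ?B \<le> Max ?A"
      proof (rule Max_mono)
      show "?B \<subseteq> ?A"
        unfolding A B by auto
    qed (use fin ne in auto)
  qed
  then show ?thesis
    by (simp add: inf_norm_def)
qed

section \<open>From strategies to feasible assignments\<close>

text \<open>Taking the exact reachability probabilities for \<open>var_p\<close> makes the bound on
  \<open>var_p\<close> at \<open>init M\<close> coincide with the specification.\<close>

definition strategy_assignment ::
  "('s::finite, 'a::finite) mdp \<Rightarrow> ('s \<Rightarrow> 'a pmf) \<Rightarrow> ('s \<Rightarrow> real) \<Rightarrow> 's set \<Rightarrow> ('s \<Rightarrow> 'a pmf) \<Rightarrow>
    ('s, 'a) assignment" where
  "strategy_assignment M \<sigma>h b T \<sigma>a =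
    \<lparr>var_a = (\<lambda>s. pmf (\<sigma>a s)), var_ha = (\<lambda>s. pmf (blend b \<sigma>h \<sigma>a s)),
     var_d = (\<lambda>s \<alpha>. pmf (blend b \<sigma>h \<sigma>a s) \<alpha> - pmf (\<sigma>h s) \<alpha>),
     var_p = (\<lambda>s. reach_prob (induced_mc M (blend b \<sigma>h \<sigma>a)) s T)\<rparr>"

lemma induces_strategy_assignment:
  fixes M :: "('s::finite, 'a::finite) mdp"
  assumes "is_strategy M \<sigma>h" and "is_strategy M \<sigma>a" and "\<forall>s. b s \<in> {0..1}"
    and "perturbs \<delta> \<sigma>h (blend b \<sigma>h \<sigma>a)"
  shows "induces M (strategy_assignment M \<sigma>h b T \<sigma>a) \<sigma>a (blend b \<sigma>h \<sigma>a) \<delta>"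
  using assms is_strategy_blend[OF assms(1-3)]
  by (simp add: induces_def strategy_assignment_def perturbs_iff is_strategy_iff)

lemma nlp_satisfying_strategy_assignment:
  fixes M :: "('s::finite, 'a::finite) mdp"
  assumes h: "is_strategy M \<sigma>h" and a: "is_strategy M \<sigma>a" and b: "\<forall>s. b s \<in> {0..1}"
    and sat: "satisfies_reach M T lam (blend b \<sigma>h \<sigma>a)"
  shows "nlp_satisfying M \<sigma>h b T lam (strategy_assignment M \<sigma>h b T \<sigma>a)"
proof -
  let ?\<sigma> = "blend b \<sigma>h \<sigma>a"
  have ha: "is_strategy M ?\<sigma>"
    by (rule is_strategy_blend[OF h a b])
  \<comment> \<open>The difference of two strategies is a perturbation, which yields the range of
    \<open>var_d\<close>.\<close>
  have "perturbs (\<lambda>s \<alpha>. pmf (?\<sigma> s) \<alpha> - pmf (\<sigma>h s) \<alpha>) \<sigma>h ?\<sigma>"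
    by (simp add: perturbs_iff)
  then have d: "pmf (?\<sigma> s) \<alpha> - pmf (\<sigma>h s) \<alpha> \<in> {-1..1}" for s \<alpha>
    unfolding perturbs_def is_perturbation_def by blast
  show ?thesis
    unfolding nlp_satisfying_def strategy_assignment_def assignment.simps
  proof (intro conjI allI ballI)
    show "reach_prob (induced_mc M ?\<sigma>) (init M) T \<le> lam"
      using sat by (simp add: satisfies_reach_def)
    show "reach_prob (induced_mc M ?\<sigma>) s T = 1" if "s \<in> T" for s
      using that by (rule reach_prob_target)
    show "(\<Sum>\<alpha>\<in>enabled M s. pmf (?\<sigma> s) \<alpha> - pmf (\<sigma>h s) \<alpha>) = 0" for s
      by (simp add: sum_subtractf sum_strategy_enabled[OF ha] sum_strategy_enabled[OF h])
    show "reach_prob (induced_mc M ?\<sigma>) s T = (\<Sum>\<alpha>\<in>enabled M s. pmf (?\<sigma> s) \<alpha> *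
        (\<Sum>s'\<in>UNIV. prob_trans M s \<alpha> s' * reach_prob (induced_mc M ?\<sigma>) s' T))"
      if "s \<in> UNIV - T" for s
      unfolding sum_induced_mc[OF ha, symmetric] using that by (intro reach_prob_step) auto
    show "pmf (?\<sigma> s) \<alpha> = b s * pmf (\<sigma>h s) \<alpha> + (1 - b s) * pmf (\<sigma>a s) \<alpha>" for s \<alpha>
      using b by (simp add: pmf_blend)
  qed (use d in \<open>simp_all add: reach_prob_range pmf_le_1 sum_strategy_enabled[OF ha]
        sum_strategy_enabled[OF a] del: atLeastAtMost_iff\<close>, simp_all add: pmf_le_1)
qed

section \<open>From feasible assignments to strategies\<close>

lemma nlp_satisfying_induces:
  fixes M :: "('s::finite, 'a::finite) mdp"
  assumes h: "is_strategy M \<sigma>h" and b: "\<forall>s. b s \<in> {0..1}"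
    and sat: "nlp_satisfying M \<sigma>h b T lam x"
  obtains \<sigma>a \<delta> where "induces M x \<sigma>a (blend b \<sigma>h \<sigma>a) \<delta>" and "is_strategy M \<sigma>a"
    and "perturbs \<delta> \<sigma>h (blend b \<sigma>h \<sigma>a)" and "satisfies_reach M T lam (blend b \<sigma>h \<sigma>a)"
proof
  \<comment> \<open>Extension by 0 to disabled actions; the range and sum constraints make this a
    probability mass function.\<close>
  define \<sigma>a where "\<sigma>a s = embed_pmf (\<lambda>\<alpha>. if \<alpha> \<in> enabled M s then var_a x s \<alpha> else 0)" for s
  define \<delta> where "\<delta> s \<alpha> = (if \<alpha> \<in> enabled M s then var_d x s \<alpha> else 0)" for s \<alpha>
  let ?\<sigma> = "blend b \<sigma>h \<sigma>a"
  have a: "pmf (\<sigma>a s) \<alpha> = (if \<alpha> \<in> enabled M s then var_a x s \<alpha> else 0)" for s \<alpha>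
    unfolding \<sigma>a_def using sat
    by (intro pmf_embed_pmf_finite) (auto simp: nlp_satisfying_def sum.If_cases)
  then show strat: "is_strategy M \<sigma>a"
    by (simp add: is_strategy_iff)
  then have strat': "is_strategy M ?\<sigma>"
    using h b by (intro is_strategy_blend)
  have h0: "pmf (\<sigma>h s) \<alpha> = 0" if "\<alpha> \<notin> enabled M s" for s \<alpha>
    using h that by (simp add: is_strategy_iff)
  have "var_ha x s \<alpha> = b s * pmf (\<sigma>h s) \<alpha> + (1 - b s) * var_a x s \<alpha>"
    if "\<alpha> \<in> enabled M s" for s \<alpha>
    using sat that unfolding nlp_satisfying_def by blast
  \<comment> \<open>On enabled actions this is the blending constraint; on disabled ones both
    blended strategies vanish.\<close>
  then have ha: "pmf (?\<sigma> s) \<alpha> = (if \<alpha> \<in> enabled M s then var_ha x s \<alpha> else 0)" for s \<alpha>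
    using b h0 by (simp add: pmf_blend a)
  show "induces M x \<sigma>a ?\<sigma> \<delta>"
    by (simp add: induces_def a ha \<delta>_def)
  have "var_ha x s \<alpha> = pmf (\<sigma>h s) \<alpha> + var_d x s \<alpha>" if "\<alpha> \<in> enabled M s" for s \<alpha>
    using sat that unfolding nlp_satisfying_def by blast
  then show "perturbs \<delta> \<sigma>h ?\<sigma>"
    using h0 by (simp add: perturbs_iff fun_eq_iff ha \<delta>_def)
  \<comment> \<open>Only an inequality can be expected: on a closed set of states avoiding
    \<open>T\<close>, any constant in [0,1] solves the equations for \<open>var_p\<close>.\<close>
  have "reach_prob (induced_mc M ?\<sigma>) (init M) T \<le> var_p x (init M)"
  proof (rule reach_prob_least)
    fix s assume "s \<notin> T"
    then show "(\<Sum>t\<in>UNIV. pmf (induced_mc M ?\<sigma> s) t * var_p x t) \<le> var_p x s"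
      using sat by (simp add: sum_induced_mc[OF strat'] ha nlp_satisfying_def)
  qed (use sat in \<open>auto simp: nlp_satisfying_def\<close>)
  then show "satisfies_reach M T lam ?\<sigma>"
    using sat by (simp add: satisfies_reach_def nlp_satisfying_def)
qed

lemma nlp_objective_eq_deviation:
  fixes M :: "('s::finite, 'a::finite) mdp"
  assumes "is_mdp M" and "induces M x \<sigma>a \<sigma>ha \<delta>" and "perturbs \<delta> \<sigma>h \<sigma>ha"
  shows "nlp_objective M x = deviation \<sigma>h \<sigma>ha"
proof -
  have "inf_norm \<delta> = nlp_objective M x"
    unfolding nlp_objective_def
    by (rule inf_norm_eq_Max_enabled) (use assms in \<open>auto simp: induces_def\<close>)
  then show ?thesis
    using assms(3) by (simp add: deviation_eq perturbs_iff)
qed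

section \<open>Soundness and completeness of the program\<close>

theorem theorem1:
  fixes M :: "('s::finite, 'a::finite) mdp"
    and T :: "'s set"
    and lam :: real
    and \<sigma>h :: "'s \<Rightarrow> 'a pmf"
    and b :: "'s \<Rightarrow> real"
  assumes "is_mdp M"
    and "lam \<in> {0..1} \<inter> \<rat>"
    and "is_strategy M \<sigma>h"
    and "\<not> satisfies_reach M T lam \<sigma>h"
    and "\<forall>s. b s \<in> {0..1}"
  shows "(\<forall>x. nlp_minimizing M \<sigma>h b T lam x \<longrightarrow>
           (\<exists>\<sigma>a \<sigma>ha \<delta>. induces M x \<sigma>a \<sigma>ha \<delta> \<and> synthesis_solution M \<sigma>h b T lam \<sigma>a \<sigma>ha \<delta>))
       \<and> (\<forall>\<sigma>a \<sigma>ha \<delta>. synthesis_solution M \<sigma>h b T lam \<sigma>a \<sigma>ha \<delta> \<longrightarrow>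
           (\<exists>x. nlp_minimizing M \<sigma>h b T lam x \<and> induces M x \<sigma>a \<sigma>ha \<delta>))"
proof -
  note mdp = assms(1) and h = assms(3) and b = assms(5)
  \<comment> \<open>Used twice: to turn competing strategies into feasible points for soundness, and
    to build the required assignment for completeness.\<close>
  have assignment: "\<exists>y. nlp_satisfying M \<sigma>h b T lam y \<and> induces M y \<sigma>a (blend b \<sigma>h \<sigma>a) \<delta> \<and>
      nlp_objective M y = deviation \<sigma>h (blend b \<sigma>h \<sigma>a)"
    if "is_strategy M \<sigma>a" "satisfies_reach M T lam (blend b \<sigma>h \<sigma>a)"
      "perturbs \<delta> \<sigma>h (blend b \<sigma>h \<sigma>a)" for \<sigma>a \<delta>
    using nlp_satisfying_strategy_assignment[OF h that(1) b that(2)]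
      induces_strategy_assignment[OF h that(1) b that(3), of T]
      nlp_objective_eq_deviation[OF mdp _ that(3)] by blast
  show ?thesis
  proof (intro conjI allI impI)
    fix x assume "nlp_minimizing M \<sigma>h b T lam x"
    then have sat: "nlp_satisfying M \<sigma>h b T lam x"
      and min: "\<And>y. nlp_satisfying M \<sigma>h b T lam y \<Longrightarrow> nlp_objective M x \<le> nlp_objective M y"
      by (auto simp: nlp_minimizing_def not_less)
    obtain \<sigma>a \<delta> where ind: "induces M x \<sigma>a (blend b \<sigma>h \<sigma>a) \<delta>" and "is_strategy M \<sigma>a"
      and pert: "perturbs \<delta> \<sigma>h (blend b \<sigma>h \<sigma>a)"
      and "satisfies_reach M T lam (blend b \<sigma>h \<sigma>a)"
      by (rule nlp_satisfying_induces[OF h b sat])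
    moreover have "deviation \<sigma>h (blend b \<sigma>h \<sigma>a) \<le> deviation \<sigma>h (blend b \<sigma>h \<sigma>a')"
      if "is_strategy M \<sigma>a' \<and> satisfies_reach M T lam (blend b \<sigma>h \<sigma>a')" for \<sigma>a'
    proof -
      \<comment> \<open>A competitor comes without a perturbation; the difference from
        \<open>\<sigma>h\<close> provides one.\<close>
      have "perturbs (\<lambda>s \<alpha>. pmf (blend b \<sigma>h \<sigma>a' s) \<alpha> - pmf (\<sigma>h s) \<alpha>) \<sigma>h (blend b \<sigma>h \<sigma>a')"
        by (simp add: perturbs_iff)
      with assignment that obtain y where "nlp_satisfying M \<sigma>h b T lam y"
        and "nlp_objective M y = deviation \<sigma>h (blend b \<sigma>h \<sigma>a')"
        by blast
      with min nlp_objective_eq_deviation[OF mdp ind pert] show ?thesis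
        by force
    qed
    ultimately have "synthesis_solution M \<sigma>h b T lam \<sigma>a (blend b \<sigma>h \<sigma>a) \<delta>"
      by (simp add: synthesis_solution_def)
    with ind show "\<exists>\<sigma>a \<sigma>ha \<delta>. induces M x \<sigma>a \<sigma>ha \<delta> \<and> synthesis_solution M \<sigma>h b T lam \<sigma>a \<sigma>ha \<delta>"
      by blast
  next
    fix \<sigma>a \<sigma>ha \<delta> assume sol: "synthesis_solution M \<sigma>h b T lam \<sigma>a \<sigma>ha \<delta>"
    then have ha: "\<sigma>ha = blend b \<sigma>h \<sigma>a"
      by (simp add: synthesis_solution_def)
    obtain x where x: "nlp_satisfying M \<sigma>h b T lam x" "induces M x \<sigma>a \<sigma>ha \<delta>"
      "nlp_objective M x = deviation \<sigma>h \<sigma>ha"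
      using assignment[of \<sigma>a \<delta>] sol unfolding ha by (auto simp: synthesis_solution_def)
    \<comment> \<open>A feasible \<open>y\<close> induces a competing strategy whose deviation is
      the objective value of \<open>y\<close>, so minimality of the solution carries over to
      \<open>x\<close>.\<close>
    have "nlp_objective M x \<le> nlp_objective M y" if sat: "nlp_satisfying M \<sigma>h b T lam y" for y
    proof -
      obtain \<sigma>a' \<delta>' where ind: "induces M y \<sigma>a' (blend b \<sigma>h \<sigma>a') \<delta>'" and "is_strategy M \<sigma>a'"
        and pert: "perturbs \<delta>' \<sigma>h (blend b \<sigma>h \<sigma>a')"
        and "satisfies_reach M T lam (blend b \<sigma>h \<sigma>a')"
        by (rule nlp_satisfying_induces[OF h b sat])
      then show ?thesis
        using sol unfolding x(3) nlp_objective_eq_deviation[OF mdp ind pert]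
        by (simp add: synthesis_solution_def ha)
    qed
    with x show "\<exists>x. nlp_minimizing M \<sigma>h b T lam x \<and> induces M x \<sigma>a \<sigma>ha \<delta>"
      by (auto simp: nlp_minimizing_def not_less)
  qed
qed

end
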